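(* Let $\mathbb{K}$ be a field of characteristic different from $2$ and let $X$ and $Y$ be linear spaces over $\mathbb{K}$. Let $f, f_{1,1}, f_{1,2}, f_{2,1}, f_{2,2}\colon X\times Y\to \mathbb{K}$ be functions that all vanish at $(0,0)$. These functions satisfy the functional equation \[ f(x_{1}+x_{2},y_{1}+y_{2})=f_{1,1}(x_{1},y_{1})+f_{1,2}(x_{1},y_{2})+f_{2,1}(x_{2},y_{1})+f_{2,2}(x_{2},y_{2}) \qquad (x_{1}, x_{2}\in X,\ y_{1}, y_{2}\in Y) \] if and only if there exist a bi-additive function $A\colon X\times Y\to \mathbb{K}$, additive functions $\chi\colon X\to \mathbb{K}$ and $\zeta\colon Y\to \mathbb{K}$, and, for $i,j\in\{1,2\}$, functions $\chi_{i,j}\colon X\to \mathbb{K}$ and $\zeta_{i,j}\colon Y\to \mathbb{K}$ vanishing at zero, such that \[ \begin{array}{rcl} f(x,z)&=&A(x,z)+\chi(x)+\zeta(z)\\ f_{i,j}(x,z)&=&A(x,z)+\chi_{i,j}(x)+\zeta_{i,j}(z) \end{array} \qquad (x\in X,\ z\in Y,\ i,j=1,2) \] and \[ \begin{array}{rcl} \chi(x)&=&\chi_{1,1}(x)+\chi_{1,2}(x)=\chi_{2,1}(x)+\chi_{2,2}(x)\\ \zeta(z)&=&\zeta_{1,1}(z)+\zeta_{2,1}(z)=\zeta_{1,2}(z)+\zeta_{2,2}(z) \end{array} \qquad (x\in X,\ z\in Y). \]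
   Context: A function between linear spaces is additive if it preserves sums; a mapping $A\colon X\times Y\to\mathbb{K}$ is bi-additive if it is additive in each of its two variables separately. *)

theory Defs
  imports Complex_Main
begin

definition bi_additive ::
    "('x::ab_group_add \<times> 'y::ab_group_add \<Rightarrow> 'k::ab_group_add) \<Rightarrow> bool" where
  "bi_additive A \<longleftrightarrow>
     (\<forall>y. additive (\<lambda>x. A (x, y))) \<and> (\<forall>x. additive (\<lambda>y. A (x, y)))"

end

theory Submission
  imports Defs
begin

text \<open>
  Under the equation, \<open>f\<close> and the \<open>f\<^bsub>i,j\<^esub>\<close> differ only by functions of a single variable.
  Switching off all variables but \<open>x\<^sub>i\<close> and \<open>y\<^sub>j\<close> gives, for instance,
  \<open>f (x, y) = f\<^bsub>1,1\<^esub> (x, y) + f\<^bsub>1,2\<^esub> (x, 0) + f\<^bsub>2,1\<^esub> (0, y)\<close>, so \<open>f\<close> and all the \<open>f\<^bsub>i,j\<^esub>\<close>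
  share the same mixed part
  \<open>A (x, y) = f (x, y) - f (x, 0) - f (0, y)\<close>. On the axes the equation becomes a Pexider
  equation, which makes \<open>\<chi> = f (\<cdot>, 0)\<close> and \<open>\<zeta> = f (0, \<cdot>)\<close> additive and also gives the
  relations between these and the restrictions of the \<open>f\<^bsub>i,j\<^esub>\<close> to the axes. Subtracting
  all functions of a single variable leaves
  \<open>A (x\<^sub>1 + x\<^sub>2, y\<^sub>1 + y\<^sub>2) = (\<Sum>i j. A (x\<^sub>i, y\<^sub>j))\<close>; as \<open>A\<close> vanishes on the axes, \<open>y\<^sub>2 = 0\<close>
  turns this into additivity in \<open>x\<close>, and \<open>x\<^sub>2 = 0\<close> into additivity in \<open>y\<close>. Conversely, substituting
  the decomposition into the equation, the one-variable parts recombine to \<open>\<chi>\<close> and \<open>\<zeta>\<close>.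
\<close>

lemma additive_if_pexider:
  fixes g a b :: "'x::ab_group_add \<Rightarrow> 'k::ab_group_add"
  assumes eq: "\<And>u v. g (u + v) = a u + b v"
    and "a 0 = 0" "b 0 = 0"
  shows "additive g"
proof
  fix u v
  have "g u = a u" "g v = b v"
    using eq[of u 0] eq[of 0 v] assms(2,3) by simp_all
  then show "g (u + v) = g u + g v"
    using eq by simp
qed

text \<open>
  With \<open>y\<^sub>2 = 0\<close> or \<open>x\<^sub>2 = 0\<close>, two of the four terms lie on an axis and drop out; what is left
  is additivity in the first or in the second variable.
\<close>

lemma bi_additive_if_additive_jointly:
  fixes A :: "'x::ab_group_add \<times> 'y::ab_group_add \<Rightarrow> 'k::ab_group_add"
  assumes joint: "\<And>x1 x2 y1 y2.
      A (x1 + x2, y1 + y2) = A (x1, y1) + A (x1, y2) + A (x2, y1) + A (x2, y2)"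
    and axes: "\<And>x. A (x, 0) = 0" "\<And>y. A (0, y) = 0"
  shows "bi_additive A"
proof -
  have "A (x1 + x2, y) = A (x1, y) + A (x2, y)" for x1 x2 y
    using joint[of x1 x2 y 0] axes by simp
  moreover have "A (x, y1 + y2) = A (x, y1) + A (x, y2)" for x y1 y2
    using joint[of x 0 y1 y2] axes by simp
  ultimately show ?thesis
    by (simp add: bi_additive_def additive_def)
qed

text \<open>
  The one-variable parts can be chosen as the restrictions of the given functions to the two
  axes: once they are removed, what is left of each function is the part \<open>A\<close> of \<open>f\<close> that
  vanishes on both axes.
\<close>

lemma axis_decomposition:
  fixes f f11 f12 f21 f22 :: "'x::ab_group_add \<times> 'y::ab_group_add \<Rightarrow> 'k::ab_group_add"
    and A :: "'x \<times> 'y \<Rightarrow> 'k"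
  defines "A \<equiv> \<lambda>(x, y). f (x, y) - f (x, 0) - f (0, y)"
  assumes eq: "\<And>x1 x2 y1 y2.
      f (x1 + x2, y1 + y2) = f11 (x1, y1) + f12 (x1, y2) + f21 (x2, y1) + f22 (x2, y2)"
    and zero: "f11 (0, 0) = 0" "f12 (0, 0) = 0" "f21 (0, 0) = 0" "f22 (0, 0) = 0"
  shows "bi_additive A"
    and "additive (\<lambda>x. f (x, 0))" "additive (\<lambda>y. f (0, y))"
    and "f11 (x, y) = A (x, y) + f11 (x, 0) + f11 (0, y)"
        "f12 (x, y) = A (x, y) + f12 (x, 0) + f12 (0, y)"
        "f21 (x, y) = A (x, y) + f21 (x, 0) + f21 (0, y)"
        "f22 (x, y) = A (x, y) + f22 (x, 0) + f22 (0, y)"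
    and "f (x, 0) = f11 (x, 0) + f12 (x, 0)" "f (x, 0) = f21 (x, 0) + f22 (x, 0)"
    and "f (0, y) = f11 (0, y) + f21 (0, y)" "f (0, y) = f12 (0, y) + f22 (0, y)"
proof -
  have x_axis: "f (x, 0) = f11 (x, 0) + f12 (x, 0)" "f (x, 0) = f21 (x, 0) + f22 (x, 0)" for x
    using eq[of x 0 0 0] eq[of 0 x 0 0] zero by simp_all
  have y_axis: "f (0, y) = f11 (0, y) + f21 (0, y)" "f (0, y) = f12 (0, y) + f22 (0, y)" for y
    using eq[of 0 0 y 0] eq[of 0 0 0 y] zero by simp_all
  show additive_x: "additive (\<lambda>x. f (x, 0))"
  proof (rule additive_if_pexider)
    show "f (u + v, 0) = (f11 (u, 0) + f12 (u, 0)) + (f21 (v, 0) + f22 (v, 0))" for u v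
      using eq[of u v 0 0] by (simp add: add.assoc)
  qed (use zero in simp_all)
  show additive_y: "additive (\<lambda>y. f (0, y))"
  proof (rule additive_if_pexider)
    show "f (0, u + v) = (f11 (0, u) + f21 (0, u)) + (f12 (0, v) + f22 (0, v))" for u v
      using eq[of 0 0 u v] by (simp add: algebra_simps)
  qed (use zero in simp_all)
  have parts: "f11 (x, y) = A (x, y) + f11 (x, 0) + f11 (0, y)"
      "f12 (x, y) = A (x, y) + f12 (x, 0) + f12 (0, y)"
      "f21 (x, y) = A (x, y) + f21 (x, 0) + f21 (0, y)"
      "f22 (x, y) = A (x, y) + f22 (x, 0) + f22 (0, y)" for x y
  proof -
    show "f11 (x, y) = A (x, y) + f11 (x, 0) + f11 (0, y)"
      using eq[of x 0 y 0] x_axis(1)[of x] y_axis(1)[of y] zero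
      by (simp add: A_def algebra_simps)
    show "f12 (x, y) = A (x, y) + f12 (x, 0) + f12 (0, y)"
      using eq[of x 0 0 y] x_axis(1)[of x] y_axis(2)[of y] zero
      by (simp add: A_def algebra_simps)
    show "f21 (x, y) = A (x, y) + f21 (x, 0) + f21 (0, y)"
      using eq[of 0 x y 0] x_axis(2)[of x] y_axis(1)[of y] zero
      by (simp add: A_def algebra_simps)
    show "f22 (x, y) = A (x, y) + f22 (x, 0) + f22 (0, y)"
      using eq[of 0 x 0 y] x_axis(2)[of x] y_axis(2)[of y] zero
      by (simp add: A_def algebra_simps)
  qed
  show "bi_additive A"
  proof (rule bi_additive_if_additive_jointly)
    fix x1 x2 :: 'x and y1 y2 :: 'y
    \<comment> \<open>The one-variable terms are grouped so that each pair is a value of \<open>f\<close> on an axis.\<close>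
    have "f (x1 + x2, y1 + y2) =
        (A (x1, y1) + A (x1, y2) + A (x2, y1) + A (x2, y2))
        + ((f11 (x1, 0) + f12 (x1, 0)) + (f21 (x2, 0) + f22 (x2, 0)))
        + ((f11 (0, y1) + f21 (0, y1)) + (f12 (0, y2) + f22 (0, y2)))"
      unfolding eq parts(1)[of x1 y1] parts(2)[of x1 y2] parts(3)[of x2 y1] parts(4)[of x2 y2]
      by (simp add: ac_simps)
    also have "\<dots> = (A (x1, y1) + A (x1, y2) + A (x2, y1) + A (x2, y2))
        + f (x1 + x2, 0) + f (0, y1 + y2)"
      by (simp only: x_axis(1)[of x1, symmetric] x_axis(2)[of x2, symmetric]
          y_axis(1)[of y1, symmetric] y_axis(2)[of y2, symmetric]
          additive.add[OF additive_x] additive.add[OF additive_y])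
    finally show "A (x1 + x2, y1 + y2) = A (x1, y1) + A (x1, y2) + A (x2, y1) + A (x2, y2)"
      by (simp add: A_def)
  qed (use x_axis(1)[of 0] zero in \<open>simp_all add: A_def\<close>)
  show "f11 (x, y) = A (x, y) + f11 (x, 0) + f11 (0, y)"
      "f12 (x, y) = A (x, y) + f12 (x, 0) + f12 (0, y)"
      "f21 (x, y) = A (x, y) + f21 (x, 0) + f21 (0, y)"
      "f22 (x, y) = A (x, y) + f22 (x, 0) + f22 (0, y)"
    by (fact parts)+
  show "f (x, 0) = f11 (x, 0) + f12 (x, 0)" "f (x, 0) = f21 (x, 0) + f22 (x, 0)"
    by (fact x_axis)+
  show "f (0, y) = f11 (0, y) + f21 (0, y)" "f (0, y) = f12 (0, y) + f22 (0, y)"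
    by (fact y_axis)+
qed

theorem proposition7:
  fixes scaleX :: "'k::field \<Rightarrow> 'x::ab_group_add \<Rightarrow> 'x"
    and scaleY :: "'k \<Rightarrow> 'y::ab_group_add \<Rightarrow> 'y"
    and f :: "'x \<times> 'y \<Rightarrow> 'k"
    and F :: "nat \<Rightarrow> nat \<Rightarrow> 'x \<times> 'y \<Rightarrow> 'k"
  assumes "CHAR('k) \<noteq> 2"
    and "vector_space scaleX"
    and "vector_space scaleY"
    and "f (0, 0) = 0"
    and "\<And>i j. i \<in> {1, 2} \<Longrightarrow> j \<in> {1, 2} \<Longrightarrow> F i j (0, 0) = 0"
  shows "(\<forall>x1 x2 y1 y2.
            f (x1 + x2, y1 + y2)
              = F 1 1 (x1, y1) + F 1 2 (x1, y2) + F 2 1 (x2, y1) + F 2 2 (x2, y2))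
     \<longleftrightarrow>
         (\<exists>(A :: 'x \<times> 'y \<Rightarrow> 'k) (\<chi> :: 'x \<Rightarrow> 'k) (\<zeta> :: 'y \<Rightarrow> 'k)
           (X :: nat \<Rightarrow> nat \<Rightarrow> 'x \<Rightarrow> 'k) (Z :: nat \<Rightarrow> nat \<Rightarrow> 'y \<Rightarrow> 'k).
            bi_additive A \<and> additive \<chi> \<and> additive \<zeta> \<and>
            (\<forall>i\<in>{1, 2}. \<forall>j\<in>{1, 2}. X i j 0 = 0 \<and> Z i j 0 = 0) \<and>
            (\<forall>x z. f (x, z) = A (x, z) + \<chi> x + \<zeta> z) \<and>
            (\<forall>i\<in>{1, 2}. \<forall>j\<in>{1, 2}. \<forall>x z. F i j (x, z) = A (x, z) + X i j x + Z i j z) \<and>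
            (\<forall>x. \<chi> x = X 1 1 x + X 1 2 x \<and> \<chi> x = X 2 1 x + X 2 2 x) \<and>
            (\<forall>z. \<zeta> z = Z 1 1 z + Z 2 1 z \<and> \<zeta> z = Z 1 2 z + Z 2 2 z))"
  (is "?equation \<longleftrightarrow> ?decomposition")
proof
  assume eq: ?equation
  have zero: "F 1 1 (0, 0) = 0" "F 1 2 (0, 0) = 0" "F 2 1 (0, 0) = 0" "F 2 2 (0, 0) = 0"
    using assms(5) by auto
  note dec = axis_decomposition[of f "F 1 1" "F 1 2" "F 2 1" "F 2 2", OF eq[rule_format] zero]
  show ?decomposition
  proof (intro exI conjI)
    let ?A = "\<lambda>(x, y). f (x, y) - f (x, 0) - f (0, y)"
    show "bi_additive ?A" "additive (\<lambda>x. f (x, 0))" "additive (\<lambda>y. f (0, y))"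
      by (fact dec(1-3))+
    show "\<forall>x z. f (x, z) = ?A (x, z) + f (x, 0) + f (0, z)"
      by simp
    show "\<forall>i\<in>{1, 2}. \<forall>j\<in>{1, 2}. F i j (0, 0) = 0 \<and> F i j (0, 0) = 0"
      using assms(5) by blast
    show "\<forall>i\<in>{1, 2}. \<forall>j\<in>{1, 2}. \<forall>x z. F i j (x, z) = ?A (x, z) + F i j (x, 0) + F i j (0, z)"
      using dec(4-7) by blast
    show "\<forall>x. f (x, 0) = F 1 1 (x, 0) + F 1 2 (x, 0) \<and> f (x, 0) = F 2 1 (x, 0) + F 2 2 (x, 0)"
      using dec(8,9) by blast
    show "\<forall>z. f (0, z) = F 1 1 (0, z) + F 2 1 (0, z) \<and> f (0, z) = F 1 2 (0, z) + F 2 2 (0, z)"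
      using dec(10,11) by blast
  qed
next
  assume ?decomposition
  then obtain A \<chi> \<zeta> X Z where A: "bi_additive A" and add: "additive \<chi>" "additive \<zeta>"
    and f: "\<And>x z. f (x, z) = A (x, z) + \<chi> x + \<zeta> z"
    and F: "\<forall>i\<in>{1, 2}. \<forall>j\<in>{1, 2}. \<forall>x z. F i j (x, z) = A (x, z) + X i j x + Z i j z"
    and \<chi>: "\<And>x. \<chi> x = X 1 1 x + X 1 2 x" "\<And>x. \<chi> x = X 2 1 x + X 2 2 x"
    and \<zeta>: "\<And>z. \<zeta> z = Z 1 1 z + Z 2 1 z" "\<And>z. \<zeta> z = Z 1 2 z + Z 2 2 z"
    by blast
  have A_add: "A (x1 + x2, y) = A (x1, y) + A (x2, y)" "A (x, y1 + y2) = A (x, y1) + A (x, y2)"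
    for x x1 x2 y y1 y2
    using A by (simp_all add: bi_additive_def additive_def)
  have F_parts: "F 1 1 (x, z) = A (x, z) + X 1 1 x + Z 1 1 z"
      "F 1 2 (x, z) = A (x, z) + X 1 2 x + Z 1 2 z"
      "F 2 1 (x, z) = A (x, z) + X 2 1 x + Z 2 1 z"
      "F 2 2 (x, z) = A (x, z) + X 2 2 x + Z 2 2 z" for x z
    using F by blast+
  show ?equation
  proof (intro allI)
    fix x1 x2 y1 y2
    have "f (x1 + x2, y1 + y2) = (A (x1, y1) + A (x1, y2) + A (x2, y1) + A (x2, y2))
        + (\<chi> x1 + \<chi> x2) + (\<zeta> y1 + \<zeta> y2)"
      by (simp add: f A_add additive.add[OF add(1)] additive.add[OF add(2)] ac_simps)
    then show "f (x1 + x2, y1 + y2)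
        = F 1 1 (x1, y1) + F 1 2 (x1, y2) + F 2 1 (x2, y1) + F 2 2 (x2, y2)"
      unfolding F_parts \<chi>(1)[of x1] \<chi>(2)[of x2] \<zeta>(1)[of y1] \<zeta>(2)[of y2]
      by (simp only: ac_simps)
  qed
qed

end
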